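(* For each $p\in(1,\infty)$, the simultaneous packing and covering constant of $\ell_p$ satisfies $\gamma(\ell_p)=2^{1-1/p}$.
   Context: $\ell_p$ is the space of real sequences $x=(x_i)_{i\in\mathbb{N}}$ with $\sum_{i=1}^\infty |x_i|^p<\infty$, with norm $\|x\|_p=\left(\sum_{i=1}^\infty |x_i|^p\right)^{1/p}$. Let $(X,\|\cdot\|)$ be a normed space, and let $B(x,r)$ denote the closed ball with center $x\in X$ and radius $r$. A subset $P\subseteq X$ is an $r$-packing if the closed balls $B(x,r)$, $x\in P$, are pairwise disjoint; equivalently, $\|x-y\|>2r$ for all distinct $x,y\in P$. A subset $P\subseteq X$ is an $R$-covering if $X=\bigcup_{x\in P}B(x,R)$. For $P\subseteq X$ define $R(P):=\inf\{R : P \text{ is an } R\text{-covering}\}$ (with the infimum of the empty set equal to $+\infty$). The simultaneous packing and covering constant of (the unit ball of) $X$ is $$\gamma(X):=\inf\{R(P) : P\subseteq X \text{ is a } 1\text{-packing}\}.$$ *)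

theory Defs
  imports "HOL-Analysis.Analysis" "HOL-Library.Function_Algebras"
begin

text \<open>
  A normed space is represented by a carrier \<open>V\<close> (a linear subspace of an ambient type)
  together with a norm \<open>N\<close> on \<open>V\<close>: the spaces \<open>\<ell>\<^sub>p\<close> depend on the real
  number \<open>p\<close>, so they cannot be instances of the class \<open>real_normed_vector\<close>.
\<close>

definition closed_ball :: "'a::ab_group_add set \<Rightarrow> ('a \<Rightarrow> real) \<Rightarrow> 'a \<Rightarrow> real \<Rightarrow> 'a set" where
  "closed_ball V N x r = {y \<in> V. N (y - x) \<le> r}"

definition is_packing :: "'a::ab_group_add set \<Rightarrow> ('a \<Rightarrow> real) \<Rightarrow> real \<Rightarrow> 'a set \<Rightarrow> bool" where
  "is_packing V N r P \<longleftrightarrow> P \<subseteq> V \<and> disjoint_family_on (\<lambda>x. closed_ball V N x r) P"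

definition is_covering :: "'a::ab_group_add set \<Rightarrow> ('a \<Rightarrow> real) \<Rightarrow> real \<Rightarrow> 'a set \<Rightarrow> bool" where
  "is_covering V N R P \<longleftrightarrow> P \<subseteq> V \<and> V = (\<Union>x\<in>P. closed_ball V N x R)"

text \<open>The infima are taken in \<open>ereal\<close>, so that the infimum of the empty set is \<open>\<infinity>\<close>.\<close>

definition covering_radius :: "'a::ab_group_add set \<Rightarrow> ('a \<Rightarrow> real) \<Rightarrow> 'a set \<Rightarrow> ereal" where
  "covering_radius V N P = Inf {ereal R |R. is_covering V N R P}"

definition packing_covering_const :: "'a::ab_group_add set \<Rightarrow> ('a \<Rightarrow> real) \<Rightarrow> ereal" where
  "packing_covering_const V N = Inf {covering_radius V N P |P. is_packing V N 1 P}"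

text \<open>Sequences are indexed from \<open>0\<close>; subtraction of sequences is pointwise.\<close>

definition lp_space :: "real \<Rightarrow> (nat \<Rightarrow> real) set" where
  "lp_space p = {x. summable (\<lambda>i. \<bar>x i\<bar> powr p)}"

definition lp_norm :: "real \<Rightarrow> (nat \<Rightarrow> real) \<Rightarrow> real" where
  "lp_norm p x = (\<Sum>i. \<bar>x i\<bar> powr p) powr (1 / p)"

end

theory Submission
  imports Defs "HOL-Complex_Analysis.Great_Picard"
begin

text \<open>
  Put \<open>r = 2 powr (1 - 1 / p)\<close>, so that \<open>2 * r powr p = 2 powr p\<close>. Both bounds rest on the
  same feature of \<open>\<ell>\<^sub>p\<close>: adding \<open>t\<close> in a coordinate where a sequence is zero, or nearly zero,
  increases the \<open>p\<close>-th power of its norm by \<open>\<bar>t\<bar> powr p\<close>, exactly or nearly. This power, here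
  called the energy, is therefore the convenient quantity to follow.

  Upper bound (a greedy construction in the style of Klee): run through a countable dense set of
  finitely supported sequences \<open>x\<close>. If \<open>x\<close> is not yet within distance \<open>r\<close> of a chosen
  point, choose in addition \<open>x + r e\<^sub>n\<close>, where \<open>n\<close> is a coordinate that neither \<open>x\<close> nor the
  points chosen so far use. The new point is at distance \<open>r\<close> from \<open>x\<close>, and the \<open>p\<close>-th power of
  its distance to every old point exceeds \<open>r powr p + r powr p = 2 powr p\<close>
  (\<open>greedy_packing_extend\<close>). The resulting packing covers with every radius above \<open>r\<close>.

  Lower bound: a bounded sequence in \<open>\<ell>\<^sub>p\<close> has a coordinatewise convergent subsequence, and far out
  in it two terms differ by essentially disjointly supported pieces. Hence a ball of radius
  \<open>M\<close> holds pairs of terms at distance at most about \<open>2 powr (1 / p) * M\<close>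
  (\<open>bounded_lp_close_pair\<close>), and a ball of radius less than \<open>r\<close> meets a \<open>1\<close>-packing in
  finitely many points only (\<open>finite_packing_in_ball\<close>). Suppose such a packing covered with radius
  \<open>R < r\<close>. From any point \<open>x\<close> make a step \<open>t e\<^sub>n\<close> with fixed \<open>t < r - R\<close> and \<open>n\<close> large. Only
  the finitely many packing points within \<open>R + t\<close> of \<open>x\<close> can be within \<open>R\<close> of the new
  point, and for all of them the \<open>p\<close>-th power of the distance has grown by nearly \<open>t powr p\<close>.
  After finitely many steps no packing point is left within \<open>R\<close> (\<open>covering_radius_lower\<close>).
\<close>

section \<open>The sequence space as a normed space\<close>

definition lp_energy :: "real \<Rightarrow> (nat \<Rightarrow> real) \<Rightarrow> real" where
  "lp_energy p x = (\<Sum>i. \<bar>x i\<bar> powr p)"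

text \<open>
  Convexity of the \<open>p\<close>-th power, applied to \<open>s + t\<close> written as the convex combination of
  \<open>s / (1 - l)\<close> and \<open>t / l\<close>. Summed over the coordinates, it gives closure under addition for
  \<open>l = 1 / 2\<close>, and Minkowski's inequality when \<open>l\<close> is the share of the second norm in the sum of
  both.
\<close>

lemma abs_add_powr_le:
  fixes s t l p :: real
  assumes p: "1 \<le> p" and l: "0 < l" "l < 1"
  shows "\<bar>s + t\<bar> powr p \<le> (1 - l) powr (1 - p) * \<bar>s\<bar> powr p + l powr (1 - p) * \<bar>t\<bar> powr p"
proof -
  have ge1: "1 \<le> c powr (1 - p)" if "0 < c" "c < 1" for c :: real
    using powr_mono'[of "1 - p" 0 c] that p by simp
  have scale: "c * (u / c) powr p = c powr (1 - p) * u powr p" if "0 < c" "0 < u" for c u :: real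
    using that by (simp add: powr_divide powr_diff)
  consider "s = 0" | "t = 0" | "s \<noteq> 0" "t \<noteq> 0" by blast
  then show ?thesis
  proof cases
    case 1
    have "1 * \<bar>t\<bar> powr p \<le> l powr (1 - p) * \<bar>t\<bar> powr p"
      by (intro mult_right_mono ge1 l) auto
    then show ?thesis using 1 by simp
  next
    case 2
    have "1 * \<bar>s\<bar> powr p \<le> (1 - l) powr (1 - p) * \<bar>s\<bar> powr p"
      by (intro mult_right_mono ge1) (use l in auto)
    then show ?thesis using 2 by simp
  next
    case 3
    have "\<bar>s + t\<bar> powr p \<le> (\<bar>s\<bar> + \<bar>t\<bar>) powr p"
      using p by (intro powr_mono2) auto
    also have "\<bar>s\<bar> + \<bar>t\<bar> = (1 - l) *\<^sub>R (\<bar>s\<bar> / (1 - l)) + l *\<^sub>R (\<bar>t\<bar> / l)"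
      using l by simp
    also have "\<dots> powr p \<le> (1 - l) * (\<bar>s\<bar> / (1 - l)) powr p + l * (\<bar>t\<bar> / l) powr p"
      using convex_onD[OF powr_convex[OF p], of l "\<bar>s\<bar> / (1 - l)" "\<bar>t\<bar> / l"] 3 l by simp
    also have "\<dots> = (1 - l) powr (1 - p) * \<bar>s\<bar> powr p + l powr (1 - p) * \<bar>t\<bar> powr p"
      using scale[of "1 - l" "\<bar>s\<bar>"] scale[of l "\<bar>t\<bar>"] 3 l by simp
    finally show ?thesis .
  qed
qed

context
  fixes p :: real
  assumes p: "1 < p"
begin

lemma lp_space_iff: "x \<in> lp_space p \<longleftrightarrow> summable (\<lambda>i. \<bar>x i\<bar> powr p)"
  by (simp add: lp_space_def)

lemma lp_space_add:
  assumes "x \<in> lp_space p" "y \<in> lp_space p"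
  shows "x + y \<in> lp_space p"
proof -
  let ?c = "(1 / 2) powr (1 - p) :: real"
  have "summable (\<lambda>i. ?c * \<bar>x i\<bar> powr p + ?c * \<bar>y i\<bar> powr p)"
    using assms by (intro summable_add summable_mult) (auto simp: lp_space_iff)
  moreover have "norm (\<bar>(x + y) i\<bar> powr p) \<le> ?c * \<bar>x i\<bar> powr p + ?c * \<bar>y i\<bar> powr p" for i
    using abs_add_powr_le[of p "1 / 2" "x i" "y i"] p by simp
  ultimately show ?thesis
    unfolding lp_space_iff by (rule summable_comparison_test')
qed

lemma lp_space_scale: "x \<in> lp_space p \<Longrightarrow> (\<lambda>i. c * x i) \<in> lp_space p"
  by (auto simp: lp_space_iff abs_mult powr_mult intro: summable_mult)

lemma lp_space_uminus: "x \<in> lp_space p \<Longrightarrow> - x \<in> lp_space p"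
  by (simp add: lp_space_iff)

lemma lp_space_diff: "x \<in> lp_space p \<Longrightarrow> y \<in> lp_space p \<Longrightarrow> x - y \<in> lp_space p"
  using lp_space_add[of x "- y"] lp_space_uminus[of y] by simp

lemma lp_energy_nonneg: "x \<in> lp_space p \<Longrightarrow> 0 \<le> lp_energy p x"
  by (auto simp: lp_energy_def lp_space_iff intro: suminf_nonneg)

lemma lp_norm_energy: "lp_norm p x = lp_energy p x powr (1 / p)"
  by (simp add: lp_norm_def lp_energy_def)

lemma lp_norm_nonneg: "0 \<le> lp_norm p x"
  by (simp add: lp_norm_def)

lemma lp_norm_uminus: "lp_norm p (- x) = lp_norm p x"
  by (simp add: lp_norm_def)

lemma lp_norm_minus_commute: "lp_norm p (x - y) = lp_norm p (y - x)"
  using lp_norm_uminus[of "x - y"] by simp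

lemma lp_norm_powr: "x \<in> lp_space p \<Longrightarrow> lp_norm p x powr p = lp_energy p x"
  using p lp_energy_nonneg[of x] by (simp add: lp_norm_energy powr_powr)

lemma lp_norm_le_iff:
  assumes "x \<in> lp_space p" "0 \<le> r"
  shows "lp_norm p x \<le> r \<longleftrightarrow> lp_energy p x \<le> r powr p"
proof -
  have "lp_norm p x \<le> r \<longleftrightarrow> lp_norm p x powr p \<le> r powr p"
    using p assms(2) lp_norm_nonneg[of x] powr_mono2[of p "lp_norm p x" r]
      powr_less_mono2[of p r "lp_norm p x"] by fastforce
  then show ?thesis
    using lp_norm_powr[OF assms(1)] by simp
qed

lemma lp_norm_scale:
  assumes "x \<in> lp_space p"
  shows "lp_norm p (\<lambda>i. c * x i) = \<bar>c\<bar> * lp_norm p x"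
proof -
  have "lp_energy p (\<lambda>i. c * x i) = \<bar>c\<bar> powr p * lp_energy p x"
    using assms by (simp add: lp_energy_def lp_space_iff abs_mult powr_mult suminf_mult)
  then show ?thesis
    using p lp_energy_nonneg[OF assms] by (simp add: lp_norm_energy powr_mult powr_powr)
qed

lemma lp_norm_eq_0:
  assumes "x \<in> lp_space p" "lp_norm p x = 0"
  shows "x = 0"
proof -
  have "lp_energy p x = 0"
    using lp_norm_powr[OF assms(1)] assms(2) by simp
  then have "\<bar>x i\<bar> powr p = 0" for i
    using assms(1) suminf_eq_zero_iff[of "\<lambda>i. \<bar>x i\<bar> powr p"]
    by (simp add: lp_energy_def lp_space_iff)
  then show ?thesis
    by (simp add: fun_eq_iff)
qed

lemma lp_norm_triangle:
  assumes x: "x \<in> lp_space p" and y: "y \<in> lp_space p"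
  shows "lp_norm p (x + y) \<le> lp_norm p x + lp_norm p y"
proof -
  define a where "a = lp_norm p x"
  define b where "b = lp_norm p y"
  have ab: "0 \<le> a" "0 \<le> b"
    by (auto simp: a_def b_def lp_norm_nonneg)
  consider "a = 0" | "b = 0" | "0 < a" "0 < b"
    using ab by linarith
  then show ?thesis
  proof cases
    case 1
    then have "x = 0" using lp_norm_eq_0[OF x] by (simp add: a_def)
    then show ?thesis using ab by (simp add: lp_norm_nonneg)
  next
    case 2
    then have "y = 0" using lp_norm_eq_0[OF y] by (simp add: b_def)
    then show ?thesis using ab by (simp add: lp_norm_nonneg)
  next
    case 3
    define l where "l = b / (a + b)"
    have l: "0 < l" "l < 1" and l': "1 - l = a / (a + b)"
      using 3 by (auto simp: l_def field_simps)
    have S: "summable (\<lambda>i. \<bar>x i\<bar> powr p)" "summable (\<lambda>i. \<bar>y i\<bar> powr p)"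
      using x y by (auto simp: lp_space_iff)
    have "lp_energy p (x + y)
        \<le> (\<Sum>i. (1 - l) powr (1 - p) * \<bar>x i\<bar> powr p + l powr (1 - p) * \<bar>y i\<bar> powr p)"
      unfolding lp_energy_def
    proof (rule suminf_le)
      show "\<bar>(x + y) i\<bar> powr p
          \<le> (1 - l) powr (1 - p) * \<bar>x i\<bar> powr p + l powr (1 - p) * \<bar>y i\<bar> powr p" for i
        using abs_add_powr_le[of p l "x i" "y i"] p l by simp
      show "summable (\<lambda>i. \<bar>(x + y) i\<bar> powr p)"
        using lp_space_add[OF x y] by (simp add: lp_space_iff)
    qed (intro summable_add summable_mult S)
    also have "\<dots> = (1 - l) powr (1 - p) * lp_energy p x + l powr (1 - p) * lp_energy p y"
      unfolding lp_energy_def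
      by (subst suminf_add[symmetric]) (auto intro!: summable_mult S simp: suminf_mult S)
    also have "\<dots> = (a / (a + b)) powr (1 - p) * a powr p + (b / (a + b)) powr (1 - p) * b powr p"
      using lp_norm_powr[OF x] lp_norm_powr[OF y] by (simp add: l' a_def b_def) (simp add: l_def a_def b_def)
    also have "\<dots> = (a + b) powr p"
    proof -
      have part: "(c / (a + b)) powr (1 - p) * c powr p = c * (a + b) powr (p - 1)"
        if "0 < c" for c
        using that 3 by (simp add: powr_divide powr_diff)
      show ?thesis
        using 3 powr_mult_base[of "a + b" "p - 1"]
        by (simp only: part[OF 3(1)] part[OF 3(2)] distrib_right[symmetric]) simp
    qed
    finally show ?thesis
      using lp_norm_le_iff[OF lp_space_add[OF x y], of "a + b"] ab by (simp add: a_def b_def)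
  qed
qed

lemma lp_norm_dist_triangle:
  assumes "x \<in> lp_space p" "y \<in> lp_space p" "z \<in> lp_space p"
  shows "lp_norm p (x - z) \<le> lp_norm p (x - y) + lp_norm p (y - z)"
  using lp_norm_triangle[of "x - y" "y - z"] lp_space_diff assms by simp

lemma lp_space_finite_support: "finite {i. x i \<noteq> 0} \<Longrightarrow> x \<in> lp_space p"
  unfolding lp_space_iff by (rule summable_finite[of "{i. x i \<noteq> 0}"]) auto

text \<open>
  If two points are at distance at most \<open>2\<close>, their midpoint lies in both balls; the converse is the
  triangle inequality.
\<close>

lemma is_packing_iff:
  "is_packing (lp_space p) (lp_norm p) 1 P \<longleftrightarrow>
    P \<subseteq> lp_space p \<and> (\<forall>x\<in>P. \<forall>y\<in>P. x \<noteq> y \<longrightarrow> 2 < lp_norm p (x - y))"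
    (is "?L \<longleftrightarrow> ?R")
proof
  assume L: ?L
  have "2 < lp_norm p (x - y)" if xy: "x \<in> P" "y \<in> P" "x \<noteq> y" for x y
  proof (rule ccontr)
    assume "\<not> ?thesis"
    then have le: "lp_norm p (x - y) \<le> 2" by simp
    have V: "x \<in> lp_space p" "y \<in> lp_space p"
      using L xy by (auto simp: is_packing_def)
    define m where "m = (\<lambda>i. (1 / 2) * (x + y) i)"
    have mV: "m \<in> lp_space p"
      unfolding m_def by (intro lp_space_scale lp_space_add V)
    have "m - x = (\<lambda>i. (- 1 / 2) * (x - y) i)" "m - y = (\<lambda>i. (1 / 2) * (x - y) i)"
      by (auto simp: m_def fun_eq_iff field_simps)
    then have "lp_norm p (m - x) \<le> 1" "lp_norm p (m - y) \<le> 1"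
      using le lp_norm_scale[OF lp_space_diff[OF V], of "- 1 / 2"]
        lp_norm_scale[OF lp_space_diff[OF V], of "1 / 2"] by simp_all
    then have "m \<in> closed_ball (lp_space p) (lp_norm p) x 1 \<inter> closed_ball (lp_space p) (lp_norm p) y 1"
      using mV by (simp add: closed_ball_def)
    then show False
      using L xy by (auto simp: is_packing_def disjoint_family_on_def)
  qed
  then show ?R using L by (auto simp: is_packing_def)
next
  assume R: ?R
  show ?L
    unfolding is_packing_def disjoint_family_on_def
  proof (intro conjI ballI impI)
    show "P \<subseteq> lp_space p" using R by blast
    fix x y assume xy: "x \<in> P" "y \<in> P" "x \<noteq> y"
    have False if "z \<in> lp_space p" "lp_norm p (z - x) \<le> 1" "lp_norm p (z - y) \<le> 1" for z
      using lp_norm_dist_triangle[of x z y] lp_norm_minus_commute[of x z] R xy that by force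
    then show "closed_ball (lp_space p) (lp_norm p) x 1 \<inter> closed_ball (lp_space p) (lp_norm p) y 1 = {}"
      by (auto simp: closed_ball_def)
  qed
qed

lemma lp_space_fun_upd: "x \<in> lp_space p \<Longrightarrow> x(n := v) \<in> lp_space p"
  and lp_energy_fun_upd:
    "x \<in> lp_space p \<Longrightarrow> lp_energy p (x(n := v)) = lp_energy p x - \<bar>x n\<bar> powr p + \<bar>v\<bar> powr p"
proof -
  assume "x \<in> lp_space p"
  then have "(\<lambda>i. \<bar>x i\<bar> powr p) sums lp_energy p x"
    by (simp add: lp_space_iff lp_energy_def summable_sums)
  then have "(\<lambda>i. if i \<in> {n} then \<bar>v\<bar> powr p else \<bar>x i\<bar> powr p)
      sums (lp_energy p x - \<bar>x n\<bar> powr p + \<bar>v\<bar> powr p)"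
    by (rule sums_If_finite_set') auto
  moreover have "(\<lambda>i. if i \<in> {n} then \<bar>v\<bar> powr p else \<bar>x i\<bar> powr p) = (\<lambda>i. \<bar>(x(n := v)) i\<bar> powr p)"
    by auto
  ultimately have "(\<lambda>i. \<bar>(x(n := v)) i\<bar> powr p) sums (lp_energy p x - \<bar>x n\<bar> powr p + \<bar>v\<bar> powr p)"
    by simp
  then show "x(n := v) \<in> lp_space p"
    "lp_energy p (x(n := v)) = lp_energy p x - \<bar>x n\<bar> powr p + \<bar>v\<bar> powr p"
    by (auto simp: lp_space_iff lp_energy_def sums_iff)
qed

lemma lp_space_tendsto_0:
  assumes "x \<in> lp_space p"
  shows "x \<longlonglongrightarrow> 0"
proof -
  have "(\<lambda>i. \<bar>x i\<bar> powr p) \<longlonglongrightarrow> 0"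
    using assms by (auto simp: lp_space_iff intro: summable_LIMSEQ_zero)
  then have "(\<lambda>i. (\<bar>x i\<bar> powr p) powr (1 / p)) \<longlonglongrightarrow> 0 powr (1 / p)"
    using p by (intro tendsto_powr') auto
  then show ?thesis
    using p by (simp add: powr_powr tendsto_rabs_zero_iff)
qed

lemma tendsto_abs_powr:
  assumes "(f \<longlongrightarrow> l) F"
  shows "((\<lambda>n. \<bar>f n :: real\<bar> powr p) \<longlongrightarrow> \<bar>l\<bar> powr p) F"
  using assms p by (intro tendsto_powr' tendsto_intros) auto

section \<open>Separated sets in balls\<close>

definition restrict_seq :: "nat set \<Rightarrow> (nat \<Rightarrow> real) \<Rightarrow> nat \<Rightarrow> real" where
  "restrict_seq A x = (\<lambda>i. if i \<in> A then x i else 0)"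

lemma restrict_seq_powr: "\<bar>restrict_seq A x i\<bar> powr p = (if i \<in> A then \<bar>x i\<bar> powr p else 0)"
  by (simp add: restrict_seq_def)

lemma lp_space_restrict: "x \<in> lp_space p \<Longrightarrow> restrict_seq A x \<in> lp_space p"
  unfolding lp_space_iff restrict_seq_powr
  by (erule summable_comparison_test'[where N = 0]) auto

lemma lp_energy_restrict_finite:
  "finite A \<Longrightarrow> lp_energy p (restrict_seq A x) = (\<Sum>i\<in>A. \<bar>x i\<bar> powr p)"
  unfolding lp_energy_def restrict_seq_powr
  by (subst suminf_finite[of A]) auto

lemma lp_energy_restrict_add:
  assumes "x \<in> lp_space p"
  shows "lp_energy p (restrict_seq A x) + lp_energy p (restrict_seq (- A) x) = lp_energy p x"
proof -
  have "(\<Sum>i. \<bar>restrict_seq A x i\<bar> powr p + \<bar>restrict_seq (- A) x i\<bar> powr p) = lp_energy p x"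
    unfolding lp_energy_def by (rule arg_cong[where f = suminf]) (auto simp: restrict_seq_def)
  then show ?thesis
    using lp_space_restrict[OF assms, of A] lp_space_restrict[OF assms, of "- A"]
    by (simp add: lp_energy_def lp_space_iff suminf_add)
qed

lemma lp_energy_restrict_le: "x \<in> lp_space p \<Longrightarrow> lp_energy p (restrict_seq A x) \<le> lp_energy p x"
  using lp_energy_restrict_add[of x A] lp_energy_nonneg[OF lp_space_restrict[of x "- A"]] by simp

lemma lp_energy_disjoint_diff:
  assumes x: "x \<in> lp_space p" and y: "y \<in> lp_space p" and disj: "A \<inter> B = {}"
  shows "lp_energy p (restrict_seq A x - restrict_seq B y) \<le> lp_energy p x + lp_energy p y"
proof -
  have "lp_energy p (restrict_seq A x - restrict_seq B y)
      = (\<Sum>i. \<bar>restrict_seq A x i\<bar> powr p + \<bar>restrict_seq B y i\<bar> powr p)"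
    unfolding lp_energy_def
    by (rule arg_cong[where f = suminf]) (use disj in \<open>auto simp: restrict_seq_def fun_eq_iff\<close>)
  also have "\<dots> = lp_energy p (restrict_seq A x) + lp_energy p (restrict_seq B y)"
    using lp_space_restrict[OF x, of A] lp_space_restrict[OF y, of B]
    by (simp add: lp_energy_def lp_space_iff suminf_add)
  also have "\<dots> \<le> lp_energy p x + lp_energy p y"
    by (intro add_mono lp_energy_restrict_le x y)
  finally show ?thesis .
qed

text \<open>
  This is where the constant comes from. Let a subsequence converge coordinatewise to \<open>x\<close>, which
  is in \<open>\<ell>\<^sub>p\<close> because the partial sums of its energy are bounded. Cut the coordinates at \<open>N\<close>,
  beyond which \<open>x\<close> is negligible, take \<open>a\<close> from the subsequence close to \<open>x\<close> below
  \<open>N\<close>, cut again at \<open>N'\<close>, beyond which \<open>a\<close> is negligible, and take a later \<open>b\<close> close to \<open>x\<close>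
  below \<open>N'\<close>. Up to small errors, \<open>a - b\<close> is then \<open>a\<close> on the middle block minus
  \<open>b\<close> on the last block, and these have disjoint supports.
\<close>

lemma bounded_lp_close_pair:
  fixes f :: "nat \<Rightarrow> nat \<Rightarrow> real"
  assumes V: "\<And>n. f n \<in> lp_space p" and M: "\<And>n. lp_norm p (f n) \<le> M" and e: "0 < e"
  shows "\<exists>m n. m < n \<and> lp_norm p (f m - f n) \<le> 2 powr (1 / p) * M + e"
proof -
  have M0: "0 \<le> M"
    using lp_norm_nonneg[of "f 0"] M[of 0] by linarith
  have E: "lp_energy p (f n) \<le> M powr p" for n
    using lp_norm_le_iff[OF V M0] M by simp
  have sum_le: "(\<Sum>i\<in>A. \<bar>f n i\<bar> powr p) \<le> M powr p" if "finite A" for n A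
    using E[of n] lp_energy_restrict_le[OF V, of A n] lp_energy_restrict_finite[OF that, of "f n"]
    by simp
  have "norm (f n i) \<le> M" for n i
  proof (rule ccontr)
    assume "\<not> ?thesis"
    then have "M powr p < \<bar>f n i\<bar> powr p"
      using M0 p by (intro powr_less_mono2) auto
    then show False using sum_le[of "{i}" n] by simp
  qed
  then obtain k where k: "strict_mono (k :: nat \<Rightarrow> nat)"
    and "\<And>i. i \<in> UNIV \<Longrightarrow> \<exists>l. (\<lambda>n. f (k n) i) \<longlonglongrightarrow> l"
    using function_convergent_subsequence[of "UNIV :: nat set" f M] by (metis countableI_type)
  then obtain x where x: "(\<lambda>n. f (k n) i) \<longlonglongrightarrow> x i" for i
    by (metis UNIV_I)
  have lim: "(\<lambda>n. \<Sum>i\<in>A. \<bar>y i - f (k n) i\<bar> powr p) \<longlonglongrightarrow> (\<Sum>i\<in>A. \<bar>y i - x i\<bar> powr p)" for A y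
    by (intro tendsto_sum tendsto_abs_powr tendsto_diff tendsto_const x)
  have "(\<Sum>i<n. \<bar>x i\<bar> powr p) \<le> M powr p" for n
    using lim[of "\<lambda>_. 0" "{..<n}"] sum_le[of "{..<n}"]
    by (intro LIMSEQ_le_const2[where X = "\<lambda>m. \<Sum>i<n. \<bar>f (k m) i\<bar> powr p"]) auto
  then have "summable (\<lambda>i. \<bar>x i\<bar> powr p)"
    by (intro summableI_nonneg_bounded) auto
  \<comment> \<open>Three error terms occur below, each of energy less than \<open>d\<close>.\<close>
  define d where "d = (e / 3) powr p"
  have d: "0 < d"
    using e by (simp add: d_def)
  have small: "lp_norm p y \<le> e / 3" if "y \<in> lp_space p" "lp_energy p y < d" for y
    using that lp_norm_le_iff[of y "e / 3"] e by (simp add: d_def)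
  obtain N where N: "\<And>n. (\<Sum>i\<in>{N..<n}. \<bar>x i\<bar> powr p) < d"
  proof -
    obtain N where "\<forall>m\<ge>N. \<forall>n. norm (\<Sum>i\<in>{m..<n}. \<bar>x i\<bar> powr p) < d"
      using \<open>summable (\<lambda>i. \<bar>x i\<bar> powr p)\<close> d unfolding summable_Cauchy by blast
    then show thesis
      using that[of N] by (metis abs_le_D1 order_refl order_le_less_trans real_norm_def)
  qed
  have "(\<lambda>m. \<Sum>i<N. \<bar>x i - f (k m) i\<bar> powr p) \<longlonglongrightarrow> 0"
    using lim[of x "{..<N}"] p by simp
  then have "\<forall>\<^sub>F m in sequentially. (\<Sum>i<N. \<bar>x i - f (k m) i\<bar> powr p) < d"
    using d by (rule order_tendstoD)
  then obtain m where m: "(\<Sum>i<N. \<bar>x i - f (k m) i\<bar> powr p) < d"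
    using eventually_happens' sequentially_bot by blast
  define a where "a = f (k m)"
  have "(\<lambda>n. \<Sum>i<n. \<bar>a i\<bar> powr p) \<longlonglongrightarrow> lp_energy p a"
    using V[of "k m"] by (auto simp: lp_space_iff a_def lp_energy_def intro: summable_LIMSEQ)
  then have "\<forall>\<^sub>F n in sequentially. lp_energy p a - d < (\<Sum>i<n. \<bar>a i\<bar> powr p)"
    using d by (intro order_tendstoD(1)) auto
  then have "\<forall>\<^sub>F n in sequentially. lp_energy p a - d < (\<Sum>i<n. \<bar>a i\<bar> powr p) \<and> N \<le> n"
    by (intro eventually_conj eventually_ge_at_top)
  then obtain N' where N': "lp_energy p a - d < (\<Sum>i<N'. \<bar>a i\<bar> powr p)" "N \<le> N'"
    using eventually_happens' sequentially_bot by blast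
  have aV: "a \<in> lp_space p" by (simp add: a_def V)
  have tail_a: "lp_energy p (restrict_seq {N'..} a) < d"
    using lp_energy_restrict_add[OF aV, of "{..<N'}"] N'(1) lp_energy_restrict_finite[of "{..<N'}" a]
    by (simp add: Compl_lessThan)
  have "\<forall>\<^sub>F n in sequentially. (\<Sum>i<N. \<bar>a i - f (k n) i\<bar> powr p) < d"
    using m by (intro order_tendstoD(2)[OF lim]) (simp add: a_def abs_minus_commute)
  moreover have "\<forall>\<^sub>F n in sequentially. (\<Sum>i\<in>{N..<N'}. \<bar>0 - f (k n) i\<bar> powr p) < d"
    using N[of N'] by (intro order_tendstoD(2)[OF lim]) simp
  ultimately have "\<forall>\<^sub>F n in sequentially. (\<Sum>i<N. \<bar>a i - f (k n) i\<bar> powr p) < d \<and>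
      (\<Sum>i\<in>{N..<N'}. \<bar>0 - f (k n) i\<bar> powr p) < d \<and> m < n"
    by (intro eventually_conj eventually_gt_at_top)
  then obtain n where n: "(\<Sum>i<N. \<bar>a i - f (k n) i\<bar> powr p) < d"
      "(\<Sum>i\<in>{N..<N'}. \<bar>f (k n) i\<bar> powr p) < d" "m < n"
    using eventually_happens' sequentially_bot by fastforce
  define b where "b = f (k n)"
  have bV: "b \<in> lp_space p" by (simp add: b_def V)
  define u where "u = restrict_seq {N..<N'} a - restrict_seq {N'..} b"
  define v where "v = restrict_seq {..<N} (a - b)"
  define w where "w = restrict_seq {N'..} a"
  define z where "z = restrict_seq {N..<N'} b"
  have V': "u \<in> lp_space p" "v \<in> lp_space p" "w \<in> lp_space p" "z \<in> lp_space p"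
    by (auto simp: u_def v_def w_def z_def intro!: lp_space_restrict lp_space_diff aV bV)
  have "{N..<N'} \<inter> {N'..} = {}"
    by auto
  then have "lp_energy p u \<le> 2 * M powr p"
    unfolding u_def
    using lp_energy_disjoint_diff[OF aV bV, of "{N..<N'}" "{N'..}"] E[of "k m"] E[of "k n"]
    by (simp add: a_def b_def)
  also have "\<dots> = (2 powr (1 / p) * M) powr p"
    using p M0 by (simp add: powr_mult powr_powr)
  finally have u: "lp_norm p u \<le> 2 powr (1 / p) * M"
    using lp_norm_le_iff[OF V'(1)] M0 by simp
  have v: "lp_norm p v \<le> e / 3"
    using V'(2) n(1) by (intro small) (auto simp: v_def lp_energy_restrict_finite b_def)
  have w: "lp_norm p w \<le> e / 3"
    using V'(3) tail_a by (intro small) (auto simp: w_def)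
  have z: "lp_norm p z \<le> e / 3"
    using V'(4) n(2) by (intro small) (auto simp: z_def lp_energy_restrict_finite b_def)
  have split: "a - b = u + (v + (w + - z))"
    using N'(2) by (auto simp: fun_eq_iff u_def v_def w_def z_def restrict_seq_def)
  have "lp_norm p (a - b) \<le> lp_norm p u + (lp_norm p v + (lp_norm p w + lp_norm p (- z)))"
    unfolding split
    by (intro order_trans[OF lp_norm_triangle] add_left_mono V' lp_space_add lp_space_uminus order_refl)
  also have "\<dots> \<le> 2 powr (1 / p) * M + e"
    using u v w z lp_norm_uminus[of z] by simp
  finally show ?thesis
    using strict_monoD[OF k n(3)] by (auto simp: a_def b_def)
qed

text \<open>
  Otherwise two of infinitely many points would be at distance at most
  \<open>2 powr (1 / p) * r + e\<close>, and \<open>e\<close> can be chosen to make this equal to \<open>2\<close>.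
\<close>

lemma finite_packing_in_ball:
  assumes P: "P \<subseteq> lp_space p" and sep: "\<And>x y. x \<in> P \<Longrightarrow> y \<in> P \<Longrightarrow> x \<noteq> y \<Longrightarrow> 2 < lp_norm p (x - y)"
    and x: "x \<in> lp_space p" and r: "r < 2 powr (1 - 1 / p)"
  shows "finite {y \<in> P. lp_norm p (x - y) \<le> r}"
proof (rule ccontr)
  assume "infinite {y \<in> P. lp_norm p (x - y) \<le> r}"
  then obtain g :: "nat \<Rightarrow> nat \<Rightarrow> real"
    where g: "inj g" "range g \<subseteq> {y \<in> P. lp_norm p (x - y) \<le> r}"
    using infinite_countable_subset by blast
  have gP: "g n \<in> P" "lp_norm p (x - g n) \<le> r" for n
    using g(2) by auto
  define e where "e = 2 - 2 powr (1 / p) * r"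
  have "2 powr (1 / p) * r < 2 powr (1 / p) * 2 powr (1 - 1 / p)"
    using r by simp
  also have "\<dots> = 2"
    by (simp add: powr_add[symmetric])
  finally have "0 < e"
    by (simp add: e_def)
  have "x - g n \<in> lp_space p" for n
    using P gP x by (auto intro: lp_space_diff)
  from bounded_lp_close_pair[of "\<lambda>n. x - g n", OF this gP(2) \<open>0 < e\<close>]
  obtain m n where "m < n" "lp_norm p ((x - g m) - (x - g n)) \<le> 2"
    unfolding e_def by auto
  moreover have "(x - g m) - (x - g n) = g n - g m"
    by simp
  moreover have "g n \<noteq> g m"
    using g(1) \<open>m < n\<close> by (auto dest: injD)
  ultimately show False
    using sep[OF gP(1) gP(1), of n m] by simp
qed

section \<open>The lower bound\<close>

text \<open>The coordinates of \<open>x\<close> tend to \<open>0\<close>, so a step along a late axis is nearly orthogonal to \<open>x\<close>.\<close>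

lemma lp_energy_push_tendsto:
  assumes "x \<in> lp_space p"
  shows "(\<lambda>n. lp_energy p (x(n := x n + t))) \<longlonglongrightarrow> lp_energy p x + \<bar>t\<bar> powr p"
proof -
  note x0 = lp_space_tendsto_0[OF assms]
  have "(\<lambda>n. lp_energy p x - \<bar>x n\<bar> powr p + \<bar>x n + t\<bar> powr p)
      \<longlonglongrightarrow> lp_energy p x - \<bar>0\<bar> powr p + \<bar>0 + t\<bar> powr p"
    by (intro tendsto_intros tendsto_abs_powr x0)
  then show ?thesis
    using p by (simp add: lp_energy_fun_upd[OF assms])
qed

lemma lp_norm_single: "lp_norm p ((0 :: nat \<Rightarrow> real)(n := t)) = \<bar>t\<bar>"
proof -
  have "(0 :: nat \<Rightarrow> real) \<in> lp_space p"
    by (rule lp_space_finite_support) simp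
  then have "lp_energy p ((0 :: nat \<Rightarrow> real)(n := t)) = \<bar>t\<bar> powr p"
    using p by (simp add: lp_energy_fun_upd) (simp add: lp_energy_def)
  then show ?thesis
    using p by (simp add: lp_norm_energy powr_powr)
qed

text \<open>
  By induction on \<open>k\<close> there is a point whose energy distance to every packing point is at least
  \<open>k * c\<close> or already above \<open>R powr p\<close>; for large \<open>k\<close> this point is not covered. The second
  alternative keeps the induction going: a packing point that is out of reach may be
  approached again when it is not among the finitely many points under control, but not to within
  \<open>R\<close>, because one step has length \<open>t\<close> only.
\<close>

lemma covering_radius_lower:
  assumes pack: "is_packing (lp_space p) (lp_norm p) 1 P"
    and cov: "is_covering (lp_space p) (lp_norm p) R P"
  shows "2 powr (1 - 1 / p) \<le> R"
proof (rule ccontr)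
  assume "\<not> ?thesis"
  then have R: "R < 2 powr (1 - 1 / p)" by simp
  have P: "P \<subseteq> lp_space p" and sep: "\<And>x y. x \<in> P \<Longrightarrow> y \<in> P \<Longrightarrow> x \<noteq> y \<Longrightarrow> 2 < lp_norm p (x - y)"
    using pack by (auto simp: is_packing_iff)
  have near: "\<exists>y\<in>P. lp_norm p (x - y) \<le> R" if "x \<in> lp_space p" for x
  proof -
    have "x \<in> (\<Union>y\<in>P. closed_ball (lp_space p) (lp_norm p) y R)"
      using cov that unfolding is_covering_def by (elim conjE) (erule subst)
    then show ?thesis by (auto simp: closed_ball_def)
  qed
  have zero: "(0 :: nat \<Rightarrow> real) \<in> lp_space p"
    by (rule lp_space_finite_support) simp
  obtain y0 where "lp_norm p (0 - y0) \<le> R"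
    using near[OF zero] by blast
  then have R0: "0 \<le> R"
    using lp_norm_nonneg order_trans by blast
  define t where "t = (2 powr (1 - 1 / p) - R) / 2"
  have t: "0 < t" "R + t < 2 powr (1 - 1 / p)"
    using R by (auto simp: t_def field_simps)
  \<comment> \<open>The limit gain of a step is \<open>t powr p\<close>; half of it is attained at a finite \<open>n\<close>.\<close>
  define c where "c = t powr p / 2"
  have c: "0 < c" "c < t powr p"
    using t by (auto simp: c_def)
  have far: "\<exists>x\<in>lp_space p. \<forall>y\<in>P. real k * c \<le> lp_energy p (x - y) \<or> R powr p < lp_energy p (x - y)" for k
  proof (induction k)
    case 0
    show ?case
    proof (intro bexI[of _ 0] ballI disjI1)
      fix y assume "y \<in> P"
      then show "real 0 * c \<le> lp_energy p (0 - y)"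
        using lp_energy_nonneg[OF lp_space_diff[OF zero, of y]] P by auto
    qed (rule zero)
  next
    case (Suc k)
    then obtain x where x: "x \<in> lp_space p"
      and xP: "\<And>y. y \<in> P \<Longrightarrow> real k * c \<le> lp_energy p (x - y) \<or> R powr p < lp_energy p (x - y)"
      by blast
    define F where "F = {y \<in> P. lp_norm p (x - y) \<le> R + t}"
    have F: "finite F"
      unfolding F_def by (rule finite_packing_in_ball[OF P sep x t(2)])
    have upd: "x(n := x n + t) - y = (x - y)(n := (x - y) n + t)" for n y
      by (auto simp: fun_eq_iff)
    have "\<forall>\<^sub>F n in sequentially. real (Suc k) * c \<le> lp_energy p (x(n := x n + t) - y)
        \<or> R powr p < lp_energy p (x(n := x n + t) - y)" if "y \<in> F" for y
    proof -
      have y: "y \<in> P" and xy: "x - y \<in> lp_space p"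
        using that P x by (auto simp: F_def intro: lp_space_diff)
      have lim: "(\<lambda>n. lp_energy p (x(n := x n + t) - y)) \<longlonglongrightarrow> lp_energy p (x - y) + t powr p"
        using lp_energy_push_tendsto[OF xy, of t] t by (simp add: upd)
      from xP[OF y] show ?thesis
      proof
        assume "real k * c \<le> lp_energy p (x - y)"
        then have "real (Suc k) * c < lp_energy p (x - y) + t powr p"
          using c by (simp add: algebra_simps)
        from order_tendstoD(1)[OF lim this] show ?thesis
          by (rule eventually_mono) auto
      next
        assume "R powr p < lp_energy p (x - y)"
        then have "R powr p < lp_energy p (x - y) + t powr p"
          using c by linarith
        from order_tendstoD(1)[OF lim this] show ?thesis
          by (rule eventually_mono) auto
      qed
    qed
    then have "\<forall>\<^sub>F n in sequentially. \<forall>y\<in>F. real (Suc k) * c \<le> lp_energy p (x(n := x n + t) - y)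
        \<or> R powr p < lp_energy p (x(n := x n + t) - y)"
      using F by (intro eventually_ball_finite) auto
    then obtain n where n: "\<forall>y\<in>F. real (Suc k) * c \<le> lp_energy p (x(n := x n + t) - y)
        \<or> R powr p < lp_energy p (x(n := x n + t) - y)"
      using eventually_happens' sequentially_bot by blast
    let ?x = "x(n := x n + t)"
    have x': "?x \<in> lp_space p"
      by (rule lp_space_fun_upd[OF x])
    have "R powr p < lp_energy p (?x - y)" if "y \<in> P" "y \<notin> F" for y
    proof -
      have yV: "y \<in> lp_space p" using that P by blast
      have "x - ?x = 0(n := - t)"
        by (auto simp: fun_eq_iff)
      then have "lp_norm p (x - ?x) = t"
        using lp_norm_single[of n "- t"] t by simp
      then have "\<not> lp_norm p (?x - y) \<le> R"
        using lp_norm_dist_triangle[OF x x' yV] that by (auto simp: F_def)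
      then show ?thesis
        using lp_norm_le_iff[OF lp_space_diff[OF x' yV] R0] by simp
    qed
    then show ?case
      using n x' by blast
  qed
  obtain k :: nat where k: "R powr p < real k * c"
    using c(1) reals_Archimedean3 by blast
  obtain x where x: "x \<in> lp_space p"
    and "\<And>y. y \<in> P \<Longrightarrow> real k * c \<le> lp_energy p (x - y) \<or> R powr p < lp_energy p (x - y)"
    using far by blast
  then have "R powr p < lp_energy p (x - y)" if "y \<in> P" for y
    using that k by fastforce
  moreover obtain y where "y \<in> P" "lp_norm p (x - y) \<le> R"
    using near[OF x] by blast
  moreover have "x - y \<in> lp_space p"
    using \<open>y \<in> P\<close> P x by (auto intro: lp_space_diff)
  ultimately show False
    using lp_norm_le_iff[of "x - y" R] R0 by fastforce
qed

section \<open>The upper bound\<close>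

definition rat_seq :: "rat list \<Rightarrow> nat \<Rightarrow> real" where
  "rat_seq l = (\<lambda>i. if i < length l then of_rat (l ! i) else 0)"

lemma finite_support_rat_seq: "finite {i. rat_seq l i \<noteq> 0}"
  by (rule finite_subset[of _ "{..<length l}"]) (auto simp: rat_seq_def)

text \<open>Truncate \<open>x\<close> where its tail has norm at most \<open>e / 2\<close>, then round the remaining entries.\<close>

lemma rat_seq_dense:
  assumes x: "x \<in> lp_space p" and e: "0 < e"
  shows "\<exists>l. lp_norm p (x - rat_seq l) \<le> e"
proof -
  have "(\<lambda>n. \<Sum>i<n. \<bar>x i\<bar> powr p) \<longlonglongrightarrow> lp_energy p x"
    using x by (auto simp: lp_space_iff lp_energy_def intro: summable_LIMSEQ)
  then have "\<forall>\<^sub>F n in sequentially. lp_energy p x - (e / 2) powr p < (\<Sum>i<n. \<bar>x i\<bar> powr p)"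
    using e by (intro order_tendstoD(1)) auto
  then obtain N where "lp_energy p x - (e / 2) powr p < (\<Sum>i<N. \<bar>x i\<bar> powr p)"
    using eventually_happens' sequentially_bot by blast
  then have "lp_energy p (restrict_seq {N..} x) \<le> (e / 2) powr p"
    using lp_energy_restrict_add[OF x, of "{..<N}"] lp_energy_restrict_finite[of "{..<N}" x]
    by (simp add: Compl_lessThan)
  then have tail: "lp_norm p (restrict_seq {N..} x) \<le> e / 2"
    using lp_norm_le_iff[OF lp_space_restrict[OF x], of "e / 2"] e by simp
  \<comment> \<open>Rounding errors \<open>h\<close> in \<open>N\<close> coordinates have total energy at most \<open>(e / 2) powr p\<close>; the
    successor avoids division by zero for \<open>N = 0\<close>.\<close>
  define h where "h = e / 2 / real (Suc N) powr (1 / p)"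
  have h: "0 < h"
    using e by (simp add: h_def)
  have "\<exists>q. \<bar>x i - of_rat q\<bar> \<le> h" for i
  proof -
    obtain q where "x i - h < of_rat q" "of_rat q < x i"
      using of_rat_dense[of "x i - h" "x i"] h by auto
    then show ?thesis by (intro exI[of _ q]) auto
  qed
  then obtain q where q: "\<bar>x i - of_rat (q i)\<bar> \<le> h" for i
    by metis
  define l where "l = map q [0..<N]"
  define y where "y = restrict_seq {..<N} (x - rat_seq l)"
  have lV: "rat_seq l \<in> lp_space p"
    by (rule lp_space_finite_support[OF finite_support_rat_seq])
  have yV: "y \<in> lp_space p"
    unfolding y_def by (intro lp_space_restrict lp_space_diff x lV)
  have "lp_energy p y = (\<Sum>i<N. \<bar>x i - of_rat (q i)\<bar> powr p)"
    unfolding y_def by (subst lp_energy_restrict_finite) (auto simp: rat_seq_def l_def)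
  also have "\<dots> \<le> (\<Sum>i<N. h powr p)"
    using q p by (intro sum_mono powr_mono2) auto
  also have "\<dots> \<le> real (Suc N) * h powr p"
    by (simp add: mult_right_mono)
  also have "\<dots> = (e / 2) powr p"
    using e p powr_divide[of "e / 2" "real (Suc N) powr (1 / p)" p]
    by (simp only: h_def) (simp add: powr_powr)
  finally have head: "lp_norm p y \<le> e / 2"
    using lp_norm_le_iff[OF yV, of "e / 2"] e by simp
  have "x - rat_seq l = y + restrict_seq {N..} x"
    by (auto simp: fun_eq_iff y_def restrict_seq_def rat_seq_def l_def)
  then have "lp_norm p (x - rat_seq l) \<le> e"
    using lp_norm_triangle[OF yV lp_space_restrict[OF x, of "{N..}"]] head tail by simp
  then show ?thesis ..
qed

text \<open>
  The state of the greedy construction. Finitely many finitely supported points always leave a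
  fresh coordinate.
\<close>

definition greedy_packing :: "(nat \<Rightarrow> real) set \<Rightarrow> bool" where
  "greedy_packing P \<longleftrightarrow> finite P \<and> (\<forall>y\<in>P. finite {i. y i \<noteq> 0}) \<and>
    (\<forall>y\<in>P. \<forall>z\<in>P. y \<noteq> z \<longrightarrow> 2 < lp_norm p (y - z))"

text \<open>
  If \<open>x\<close> is not covered, then \<open>x\<close> moved by \<open>r = 2 powr (1 - 1 / p)\<close> along a fresh axis is
  added. For an old point \<open>y\<close>, the energy of the difference is that of \<open>x - y\<close>, which exceeds
  \<open>r powr p\<close> because \<open>x\<close> is not covered, plus \<open>r powr p\<close> from the fresh coordinate.
\<close>

lemma greedy_packing_extend:
  assumes P: "greedy_packing P" and x: "finite {i. x i \<noteq> 0}"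
  shows "\<exists>Q. greedy_packing Q \<and> P \<subseteq> Q \<and> (\<exists>y\<in>Q. lp_norm p (x - y) \<le> 2 powr (1 - 1 / p))"
proof (cases "\<exists>y\<in>P. lp_norm p (x - y) \<le> 2 powr (1 - 1 / p)")
  case True
  then show ?thesis using P by blast
next
  case False
  let ?r = "2 powr (1 - 1 / p) :: real"
  have "finite ({i. x i \<noteq> 0} \<union> (\<Union>y\<in>P. {i. y i \<noteq> 0}))"
    using P x by (auto simp: greedy_packing_def)
  then obtain n where "n \<notin> {i. x i \<noteq> 0} \<union> (\<Union>y\<in>P. {i. y i \<noteq> 0})"
    using ex_new_if_finite[OF infinite_UNIV_nat] by blast
  then have n: "x n = 0" "\<And>y. y \<in> P \<Longrightarrow> y n = 0"
    by auto
  define w where "w = x(n := ?r)"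
  have xV: "x \<in> lp_space p"
    by (rule lp_space_finite_support[OF x])
  have wV: "w \<in> lp_space p"
    unfolding w_def by (rule lp_space_fun_upd[OF xV])
  have far: "2 < lp_norm p (w - y)" if y: "y \<in> P" for y
  proof -
    have yV: "y \<in> lp_space p"
      using P y by (auto simp: greedy_packing_def intro: lp_space_finite_support)
    have xy: "x - y \<in> lp_space p"
      by (rule lp_space_diff[OF xV yV])
    have "w - y = (x - y)(n := ?r)"
      using n y by (auto simp: w_def fun_eq_iff)
    then have "lp_energy p (w - y) = lp_energy p (x - y) + ?r powr p"
      using lp_energy_fun_upd[OF xy, of n ?r] n y p by simp
    moreover have "?r powr p < lp_energy p (x - y)"
      using False y lp_norm_le_iff[OF xy, of ?r] by force
    moreover have "?r powr p + ?r powr p = 2 powr p"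
    proof -
      have "?r powr p = 2 powr (p - 1)"
        using p by (simp only: powr_powr) (simp add: left_diff_distrib)
      then show ?thesis
        using powr_mult_base[of 2 "p - 1"] by simp
    qed
    ultimately have "2 powr p < lp_energy p (w - y)"
      by linarith
    then show ?thesis
      using lp_norm_le_iff[OF lp_space_diff[OF wV yV], of 2] by force
  qed
  have "finite {i. w i \<noteq> 0}"
    by (rule finite_subset[of _ "insert n {i. x i \<noteq> 0}"]) (use x in \<open>auto simp: w_def\<close>)
  then have "greedy_packing (insert w P)"
    using P far lp_norm_minus_commute[of _ w] by (auto simp: greedy_packing_def)
  moreover have "x - w = 0(n := - ?r)"
    using n by (auto simp: w_def fun_eq_iff)
  then have "lp_norm p (x - w) \<le> ?r"
    using lp_norm_single[of n "- ?r"] by simp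
  ultimately show ?thesis by blast
qed

lemma exists_packing:
  "\<exists>P. is_packing (lp_space p) (lp_norm p) 1 P \<and>
    (\<forall>R > 2 powr (1 - 1 / p). is_covering (lp_space p) (lp_norm p) R P)"
proof -
  let ?r = "2 powr (1 - 1 / p) :: real"
  define X where "X k = rat_seq (from_nat k)" for k
  have "\<exists>Q. \<forall>k. greedy_packing (Q k) \<and> (Q k \<subseteq> Q (Suc k) \<and> (\<exists>y\<in>Q (Suc k). lp_norm p (X k - y) \<le> ?r))"
  proof (rule dependent_nat_choice)
    show "\<exists>P. greedy_packing P"
      by (rule exI[of _ "{}"]) (simp add: greedy_packing_def)
    show "\<exists>Q. greedy_packing Q \<and> (P \<subseteq> Q \<and> (\<exists>y\<in>Q. lp_norm p (X k - y) \<le> ?r))"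
      if "greedy_packing P" for P k
      using greedy_packing_extend[OF that, of "X k"] finite_support_rat_seq by (auto simp: X_def)
  qed
  then obtain Q where Q: "\<And>k. greedy_packing (Q k)" and mono: "\<And>k. Q k \<subseteq> Q (Suc k)"
    and near: "\<And>k. \<exists>y\<in>Q (Suc k). lp_norm p (X k - y) \<le> ?r"
    by blast
  define P where "P = (\<Union>k. Q k)"
  have PV: "P \<subseteq> lp_space p"
    using Q by (auto simp: P_def greedy_packing_def intro: lp_space_finite_support)
  have "2 < lp_norm p (y - z)" if yz: "y \<in> P" "z \<in> P" "y \<noteq> z" for y z
  proof -
    obtain i j where "y \<in> Q i" "z \<in> Q j"
      using yz unfolding P_def by blast
    then have "y \<in> Q (max i j)" "z \<in> Q (max i j)"
      using lift_Suc_mono_le[of Q, OF mono] by (meson max.cobounded1 max.cobounded2 subsetD)+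
    then show ?thesis
      using Q[of "max i j"] that by (auto simp: greedy_packing_def)
  qed
  then have "is_packing (lp_space p) (lp_norm p) 1 P"
    using PV by (auto simp: is_packing_iff)
  moreover have "is_covering (lp_space p) (lp_norm p) R P" if R: "?r < R" for R
  proof -
    have "\<exists>y\<in>P. lp_norm p (x - y) \<le> R" if x: "x \<in> lp_space p" for x
    proof -
      obtain l where l: "lp_norm p (x - rat_seq l) \<le> R - ?r"
        using rat_seq_dense[OF x, of "R - ?r"] R by auto
      obtain y where y: "y \<in> Q (Suc (to_nat l))" "lp_norm p (rat_seq l - y) \<le> ?r"
        using near[of "to_nat l"] by (auto simp: X_def)
      then have yP: "y \<in> P" by (auto simp: P_def)
      have "lp_norm p (x - y) \<le> R"
        using lp_norm_dist_triangle[OF x lp_space_finite_support[OF finite_support_rat_seq], of y l]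
          yP PV l y by auto
      then show ?thesis using yP by blast
    qed
    then show ?thesis
      using PV by (auto simp: is_covering_def closed_ball_def)
  qed
  ultimately show ?thesis by blast
qed

end

theorem mainTheorem1:
  fixes p :: real
  assumes "1 < p"
  shows "packing_covering_const (lp_space p) (lp_norm p) = ereal (2 powr (1 - 1 / p))"
proof (rule antisym)
  obtain P where P: "is_packing (lp_space p) (lp_norm p) 1 P"
    and cov: "\<And>R. 2 powr (1 - 1 / p) < R \<Longrightarrow> is_covering (lp_space p) (lp_norm p) R P"
    using exists_packing[OF assms] by blast
  show "packing_covering_const (lp_space p) (lp_norm p) \<le> ereal (2 powr (1 - 1 / p))"
  proof (rule ereal_le_epsilon2)
    fix e :: real
    assume "0 < e"
    then have "is_covering (lp_space p) (lp_norm p) (2 powr (1 - 1 / p) + e) P"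
      by (intro cov) simp
    then have "covering_radius (lp_space p) (lp_norm p) P \<le> ereal (2 powr (1 - 1 / p) + e)"
      unfolding covering_radius_def by (intro Inf_lower) blast
    moreover have "packing_covering_const (lp_space p) (lp_norm p) \<le> covering_radius (lp_space p) (lp_norm p) P"
      unfolding packing_covering_const_def using P by (intro Inf_lower) blast
    ultimately show "packing_covering_const (lp_space p) (lp_norm p) \<le> ereal (2 powr (1 - 1 / p)) + ereal e"
      by simp
  qed
  show "ereal (2 powr (1 - 1 / p)) \<le> packing_covering_const (lp_space p) (lp_norm p)"
    unfolding packing_covering_const_def covering_radius_def
    using covering_radius_lower[OF assms] by (auto intro!: Inf_greatest)
qed

end
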